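(* For every integer $d \geq 2$, the Turán number for homeomorphs of $S^d$ satisfies, as $n \to \infty$, $$\operatorname{ex}(n, S^d) \leq O\left(n^{d + 1 - 1/2^{d - 1}}\right),$$ where the implied constant may depend on $d$ but not on $n$.
   Context: A simplicial $d$-sphere (a homeomorph of $S^d$) is a simplicial complex homeomorphic to the $d$-dimensional sphere $S^d$. Pure $d$-dimensional simplicial complexes are regarded as equivalent to $(d+1)$-uniform hypergraphs (the hyperedges being the vertex sets of the $d$-faces); the $d$-faces are called facets. $\operatorname{ex}(n, S^d)$ denotes the maximum number of facets ($d$-dimensional faces) in a pure $d$-dimensional simplicial complex on $n$ vertices that does not contain any simplicial $d$-sphere as a subcomplex. *)

theory Defs
  imports "HOL-Analysis.Analysis" "HOL-Library.Landau_Symbols"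
begin

(* Finite abstract simplicial complexes. The empty face is left out, so the vertex set
   of K is \<Union>K and a face of dimension d has d + 1 elements. *)

definition abstract_simplicial_complex :: "'a set set \<Rightarrow> bool" where
  "abstract_simplicial_complex K \<longleftrightarrow>
     finite K \<and>
     (\<forall>\<sigma>\<in>K. finite \<sigma> \<and> \<sigma> \<noteq> {}) \<and>
     (\<forall>\<sigma>\<in>K. \<forall>\<tau>. \<tau> \<subseteq> \<sigma> \<and> \<tau> \<noteq> {} \<longrightarrow> \<tau> \<in> K)"

definition faces_of_dim :: "nat \<Rightarrow> 'a set set \<Rightarrow> 'a set set" where
  "faces_of_dim d K = {\<sigma> \<in> K. card \<sigma> = d + 1}"

(* The complex without faces counts as pure of every dimension: it corresponds to the
   (d+1)-uniform hypergraph without edges. *)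

definition pure_complex :: "nat \<Rightarrow> 'a set set \<Rightarrow> bool" where
  "pure_complex d K \<longleftrightarrow>
     abstract_simplicial_complex K \<and>
     (\<forall>\<sigma>\<in>K. (\<forall>\<tau>\<in>K. \<sigma> \<subseteq> \<tau> \<longrightarrow> \<tau> = \<sigma>) \<longrightarrow> card \<sigma> = d + 1)"

(* Points are given by barycentric coordinates. For finite K the topology inherited from
   the product of real lines is the usual (weak) topology of the realization. *)

definition geometric_realization :: "'a set set \<Rightarrow> ('a \<Rightarrow> real) topology" where
  "geometric_realization K =
     subtopology (powertop_real UNIV)
       {x. (\<forall>v. 0 \<le> x v) \<and> {v. x v \<noteq> 0} \<in> K \<and> (\<Sum>v | x v \<noteq> 0. x v) = 1}"

definition simplicial_sphere :: "nat \<Rightarrow> 'a set set \<Rightarrow> bool" where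
  "simplicial_sphere d L \<longleftrightarrow>
     abstract_simplicial_complex L \<and> geometric_realization L homeomorphic_space nsphere d"

(* As for hypergraphs, some of the n vertices may lie in no face. *)

definition sphere_free_complexes :: "nat \<Rightarrow> nat \<Rightarrow> nat set set set" where
  "sphere_free_complexes n d =
     {K. pure_complex d K \<and> \<Union>K \<subseteq> {..<n} \<and> \<not> (\<exists>L. L \<subseteq> K \<and> simplicial_sphere d L)}"

definition ex_sphere :: "nat \<Rightarrow> nat \<Rightarrow> nat" where
  "ex_sphere n d = Max ((\<lambda>K. card (faces_of_dim d K)) ` sphere_free_complexes n d)"

(* The maximum is over a finite nonempty set. *)

lemma finite_sphere_free_complexes: "finite (sphere_free_complexes n d)"
proof (rule finite_subset)
  show "sphere_free_complexes n d \<subseteq> Pow (Pow {..<n})"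
    by (auto simp: sphere_free_complexes_def)
qed simp

lemma empty_in_sphere_free_complexes: "{} \<in> sphere_free_complexes n d"
proof -
  have "\<not> simplicial_sphere d ({} :: nat set set)"
  proof
    assume "simplicial_sphere d ({} :: nat set set)"
    then have "(trivial_topology :: (nat \<Rightarrow> real) topology) homeomorphic_space nsphere d"
      by (simp add: simplicial_sphere_def geometric_realization_def)
    then show False
      using homeomorphic_empty_space by fastforce
  qed
  then show ?thesis
    by (simp add: sphere_free_complexes_def pure_complex_def abstract_simplicial_complex_def)
qed

end

theory Submission
  imports Defs
begin

text \<open>
  The bound is proved by induction on the dimension, in the explicit form
  \<open>ex_simplicial_sphere_if_many_edges\<close>: more than \<open>2 n\<^sup>p\<close> hyperedges with \<open>p = d + 1 - 1/2\<^sup>d\<^sup>-\<^sup>1\<close> on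
  \<open>n\<close> vertices force a simplicial \<open>d\<close>-sphere all of whose faces lie in hyperedges. The constant 2
  serves every dimension.

  For \<open>d = 1\<close> the exponent is 1: a graph with at least as many edges as vertices contains a cycle,
  and a cycle of at least three vertices is a triangulated circle (\<open>simplicial_sphere_cycle\<close>).

  For the step, suppose that two vertices \<open>x\<close> and \<open>y\<close> have many hyperedges in common in their links.
  By induction the common link carries a \<open>d\<close>-sphere \<open>L\<close>. It avoids \<open>x\<close> and \<open>y\<close>, and its suspension with
  apexes \<open>x\<close> and \<open>y\<close> is a \<open>(d + 1)\<close>-sphere (\<open>simplicial_sphere_suspension\<close>) covered by hyperedges of the
  given hypergraph. Such a pair exists by counting the triples \<open>(x, y, e)\<close> with \<open>e\<close> in both links
  (\<open>ex_large_common_link\<close>). By Cauchy-Schwarz there are at least about \<open>|H|\<^sup>2 / n\<^sup>d\<^sup>+\<^sup>1\<close> of them, so some pair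
  shares about \<open>|H|\<^sup>2 / n\<^sup>d\<^sup>+\<^sup>3\<close> faces. If the exponent of \<open>n\<close> in \<open>|H|\<close> is \<open>q\<close>, the common link has exponent
  \<open>2 q - d - 3\<close>; hence the exponents in consecutive dimensions satisfy \<open>q = (p + d + 3) / 2\<close>. Each step halves the
  gap between the exponent and the trivial one, which is where the power of two comes from.

  The topological work is to identify realizations with spheres. Both the realization of a suspension and
  the sphere of the next dimension are unions of horizontal slices at heights between -1 and 1, each a
  rescaled copy of the equator, with the scaling factor vanishing exactly at the two poles. Only
  this profile of scaling factors differs, and it does not affect the topology (\<open>suspension_points_homeomorphic\<close>).
\<close>

section \<open>Realizations and spheres as sets of real functions\<close>

text \<open>
  As a bare set in the product topology of the function type, a realization can be handled by \<open>continuous_on\<close>,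
  \<open>homeomorphic\<close> and paths.
\<close>

definition realized_points :: "'a set set \<Rightarrow> ('a \<Rightarrow> real) set" where
  "realized_points K =
     {x. (\<forall>v. 0 \<le> x v) \<and> {v. x v \<noteq> 0} \<in> K \<and> (\<Sum>v | x v \<noteq> 0. x v) = 1}"

definition nsphere_points :: "nat \<Rightarrow> (nat \<Rightarrow> real) set" where
  "nsphere_points n = {x. (\<Sum>i\<le>n. (x i)\<^sup>2) = 1 \<and> (\<forall>i>n. x i = 0)}"

lemma geometric_realization_eq: "geometric_realization K = top_of_set (realized_points K)"
  by (simp add: geometric_realization_def realized_points_def euclidean_product_topology)

lemma nsphere_eq: "nsphere n = top_of_set (nsphere_points n)"
  by (simp add: nsphere nsphere_points_def euclidean_product_topology)

lemma homeomorphic_space_top_of_set: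
  "top_of_set S homeomorphic_space top_of_set T \<longleftrightarrow> S homeomorphic T"
proof -
  have "homeomorphic_maps (top_of_set S) (top_of_set T) f g \<longleftrightarrow> homeomorphism S T f g" for f g
  proof
    assume hm: "homeomorphic_maps (top_of_set S) (top_of_set T) f g"
    show "homeomorphism S T f g"
    proof
      show "continuous_on S f" "continuous_on T g" "f ` S \<subseteq> T" "g ` T \<subseteq> S"
        using hm unfolding homeomorphic_maps_def continuous_map_subtopology_eu by blast+
      show "g (f x) = x" if "x \<in> S" for x
        using hm that by (simp add: homeomorphic_maps_def)
      show "f (g y) = y" if "y \<in> T" for y
        using hm that by (simp add: homeomorphic_maps_def)
    qed
  next
    assume "homeomorphism S T f g"
    then show "homeomorphic_maps (top_of_set S) (top_of_set T) f g"
      unfolding homeomorphic_maps_def homeomorphism_def continuous_map_subtopology_eu by auto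
  qed
  then show ?thesis
    by (simp add: homeomorphic_space_def homeomorphic_def)
qed

lemma simplicial_sphere_iff:
  "simplicial_sphere d L \<longleftrightarrow>
     abstract_simplicial_complex L \<and> realized_points L homeomorphic nsphere_points d"
  by (simp add: simplicial_sphere_def geometric_realization_eq nsphere_eq homeomorphic_space_top_of_set)

section \<open>Rescaled suspensions\<close>

lemma continuous_on_fun_upd [continuous_intros]:
  fixes f :: "'a::topological_space \<Rightarrow> 'b \<Rightarrow> 'c::topological_space"
  assumes "continuous_on S f" "continuous_on S g"
  shows "continuous_on S (\<lambda>x. (f x)(c := g x))"
proof (rule continuous_on_coordinatewise_then_product)
  show "continuous_on S (\<lambda>x. ((f x)(c := g x)) i)" for i
    using assms(2) continuous_on_product_then_coordinatewise[OF assms(1)] by (cases "i = c") auto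
qed

lemma continuous_on_coordinate: "continuous_on S (\<lambda>x :: 'a \<Rightarrow> 'b::topological_space. x i)"
  by (rule continuous_on_product_then_coordinatewise) (rule continuous_on_id)

text \<open>
  The second factor may be discontinuous, or without meaning, where the first one vanishes: as it is bounded,
  the product is squeezed to 0 there. This is how continuity at the poles of a suspension is obtained.
\<close>

lemma continuous_on_mult_vanishing:
  fixes h k :: "'a::topological_space \<Rightarrow> real"
  assumes h: "continuous_on S h"
    and k: "continuous_on {x \<in> S. h x \<noteq> 0} k"
    and bound: "\<And>x. x \<in> S \<Longrightarrow> h x \<noteq> 0 \<Longrightarrow> \<bar>k x\<bar> \<le> B"
  shows "continuous_on S (\<lambda>x. h x * k x)"
  unfolding continuous_on_def
proof
  fix x assume x: "x \<in> S"
  show "((\<lambda>x. h x * k x) \<longlongrightarrow> h x * k x) (at x within S)"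
  proof (cases "h x = 0")
    case True
    have "(h \<longlongrightarrow> 0) (at x within S)"
      using h x True by (force simp: continuous_on_def)
    moreover have "\<forall>\<^sub>F y in at x within S. norm (h y * k y) \<le> norm (h y) * B"
      unfolding eventually_at_topological
    proof (intro exI[of _ UNIV] conjI ballI impI)
      fix y assume "y \<in> S"
      then show "norm (h y * k y) \<le> norm (h y) * B"
        using bound by (cases "h y = 0") (auto simp: abs_mult intro: mult_left_mono)
    qed auto
    ultimately show ?thesis
      using True by (simp add: tendsto_0_le)
  next
    case False
    let ?U = "{x \<in> S. h x \<noteq> 0}"
    have "continuous_on ?U (\<lambda>x. h x * k x)"
      using k continuous_on_subset[OF h] by (intro continuous_on_mult) auto
    then have "((\<lambda>x. h x * k x) \<longlongrightarrow> h x * k x) (at x within ?U)"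
      using x False by (simp add: continuous_on_def)
    moreover have "\<forall>\<^sub>F y in at x within S. h y \<noteq> 0"
      using h x False by (intro tendsto_imp_eventually_ne) (auto simp: continuous_on_def)
    then have "at x within ?U = at x within S"
      by (auto simp: filter_eq_iff eventually_at_filter elim: eventually_elim2)
    ultimately show ?thesis by simp
  qed
qed

text \<open>
  The factor by which the equator is rescaled at height \<open>s\<close>.
\<close>

definition profile :: "(real \<Rightarrow> real) \<Rightarrow> bool" where
  "profile w \<longleftrightarrow> continuous_on {-1..1} w \<and> w (-1) = 0 \<and> w 1 = 0 \<and> (\<forall>s\<in>{-1<..<1}. 0 < w s)"

definition suspension_points :: "(real \<Rightarrow> real) \<Rightarrow> ('a \<Rightarrow> real) set \<Rightarrow> (('a \<Rightarrow> real) \<times> real) set" where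
  "suspension_points w A = {(\<lambda>v. w s * x v, s) |x s. x \<in> A \<and> s \<in> {-1..1}}"

lemma suspension_pointsI:
  "y \<in> A \<Longrightarrow> s \<in> {-1..1} \<Longrightarrow> p = (\<lambda>v. w s * y v, s) \<Longrightarrow> p \<in> suspension_points w A"
  by (auto simp: suspension_points_def)

text \<open>
  At the poles \<open>w s = 0\<close>, and \<open>f\<close> is then applied to the constant 0, which need not lie in its
  domain; the factor \<open>u s = 0\<close> erases the result.
\<close>

definition suspension_map ::
  "(real \<Rightarrow> real) \<Rightarrow> (real \<Rightarrow> real) \<Rightarrow> (('a \<Rightarrow> real) \<Rightarrow> ('b \<Rightarrow> real)) \<Rightarrow>
   ('a \<Rightarrow> real) \<times> real \<Rightarrow> ('b \<Rightarrow> real) \<times> real" where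
  "suspension_map w u f = (\<lambda>(y, s). (\<lambda>v. u s * f (\<lambda>a. y a / w s) v, s))"

lemma profile_eq_0_iff:
  assumes "profile w" "s \<in> {-1..1}"
  shows "w s = 0 \<longleftrightarrow> s = -1 \<or> s = 1"
proof -
  have "s = -1 \<or> s = 1 \<or> s \<in> {-1<..<1}" using assms(2) by force
  then show ?thesis using assms(1) unfolding profile_def by force
qed

lemma suspension_map_apply:
  assumes "profile w" "profile u" "s \<in> {-1..1}"
  shows "suspension_map w u f (\<lambda>v. w s * x v, s) = (\<lambda>v. u s * f x v, s)"
proof (cases "w s = 0")
  case True
  then have "u s = 0"
    using assms by (simp add: profile_eq_0_iff)
  then show ?thesis
    by (simp add: suspension_map_def)
qed (simp add: suspension_map_def)

text \<open>
  Away from the poles this is a composition of continuous maps, and at the poles the bounded values of \<open>f\<close>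
  are multiplied by a factor that tends to 0.
\<close>

lemma continuous_on_suspension_map:
  assumes w: "profile w" and u: "profile u"
    and f: "continuous_on A f" and bound: "\<And>x i. x \<in> A \<Longrightarrow> \<bar>f x i\<bar> \<le> 1"
  shows "continuous_on (suspension_points w A) (suspension_map w u f)"
proof -
  let ?S = "suspension_points w A"
  have s_range: "snd p \<in> {-1..1}" if "p \<in> ?S" for p
    using that by (auto simp: suspension_points_def)
  have snd_cont: "continuous_on ?S (\<lambda>p. g (snd p))" if "profile g" for g
  proof (rule continuous_on_compose2[OF _ continuous_on_snd[OF continuous_on_id]])
    show "continuous_on {-1..1} g"
      using that by (simp add: profile_def)
  qed (use s_range in auto)
  have zero: "u (snd p) = 0 \<longleftrightarrow> w (snd p) = 0" if "p \<in> ?S" for p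
    using that s_range u w by (simp add: profile_eq_0_iff)
  have in_A: "(\<lambda>a. fst p a / w (snd p)) \<in> A" if "p \<in> ?S" "u (snd p) \<noteq> 0" for p
    using that zero[OF that(1)] by (auto simp: suspension_points_def)
  have "continuous_on ?S (\<lambda>p. u (snd p) * f (\<lambda>a. fst p a / w (snd p)) v)" for v
  proof (rule continuous_on_mult_vanishing[OF snd_cont[OF u], where B = 1])
    let ?U = "{p \<in> ?S. u (snd p) \<noteq> 0}"
    have "continuous_on ?U (\<lambda>p. fst p a)" for a
      by (rule continuous_on_product_then_coordinatewise) (rule continuous_on_fst[OF continuous_on_id])
    moreover have "continuous_on ?U (\<lambda>p. w (snd p))"
      by (rule continuous_on_subset[OF snd_cont[OF w]]) auto
    ultimately have "continuous_on ?U (\<lambda>p. (\<lambda>a. fst p a / w (snd p)))"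
      using zero by (intro continuous_on_coordinatewise_then_product continuous_on_divide) auto
    then have "continuous_on ?U (\<lambda>p. f (\<lambda>a. fst p a / w (snd p)))"
      by (rule continuous_on_compose2[OF f]) (use in_A in auto)
    then show "continuous_on ?U (\<lambda>p. f (\<lambda>a. fst p a / w (snd p)) v)"
      by (rule continuous_on_product_then_coordinatewise)
  qed (use in_A bound in auto)
  then show ?thesis
    unfolding suspension_map_def case_prod_unfold
    by (intro continuous_on_Pair continuous_on_coordinatewise_then_product)
       (auto intro: continuous_on_snd continuous_on_id)
qed

text \<open>
  The maps suspended from a homeomorphism and from its inverse are inverse to each other, and they are continuous for
  the same reason, with the two profiles exchanged.
\<close>

lemma suspension_points_homeomorphic:
  assumes w: "profile w" and u: "profile u"
    and hom: "A homeomorphic B"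
    and A: "\<And>x i. x \<in> A \<Longrightarrow> \<bar>x i\<bar> \<le> 1" and B: "\<And>x i. x \<in> B \<Longrightarrow> \<bar>x i\<bar> \<le> 1"
  shows "suspension_points w A homeomorphic suspension_points u B"
proof -
  obtain f g where fg: "homeomorphism A B f g"
    using hom by (auto simp: homeomorphic_def)
  have img: "f x \<in> B" "g (f x) = x" if "x \<in> A" for x
    using fg that by (auto simp: homeomorphism_def)
  have img': "g y \<in> A" "f (g y) = y" if "y \<in> B" for y
    using fg that by (auto simp: homeomorphism_def)
  have "homeomorphism (suspension_points w A) (suspension_points u B)
          (suspension_map w u f) (suspension_map u w g)"
  proof
    show "continuous_on (suspension_points w A) (suspension_map w u f)"
      using fg img B by (intro continuous_on_suspension_map w u) (auto simp: homeomorphism_def)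
    show "continuous_on (suspension_points u B) (suspension_map u w g)"
      using fg img' A by (intro continuous_on_suspension_map w u) (auto simp: homeomorphism_def)
    show "suspension_map w u f ` suspension_points w A \<subseteq> suspension_points u B"
      using img by (force simp: suspension_points_def suspension_map_apply[OF w u])
    show "suspension_map u w g ` suspension_points u B \<subseteq> suspension_points w A"
      using img' by (force simp: suspension_points_def suspension_map_apply[OF u w])
    show "suspension_map u w g (suspension_map w u f p) = p" if "p \<in> suspension_points w A" for p
      using that img
      by (auto simp: suspension_points_def suspension_map_apply[OF w u] suspension_map_apply[OF u w])
    show "suspension_map w u f (suspension_map u w g p) = p" if "p \<in> suspension_points u B" for p
      using that img'
      by (auto simp: suspension_points_def suspension_map_apply[OF w u] suspension_map_apply[OF u w])
  qed
  then show ?thesis by (auto simp: homeomorphic_def)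
qed

lemma nsphere_points_bounded:
  assumes "x \<in> nsphere_points n" shows "\<bar>x i\<bar> \<le> 1"
proof (cases "i \<le> n")
  case True
  then have "(x i)\<^sup>2 \<le> (\<Sum>i\<le>n. (x i)\<^sup>2)"
    by (intro member_le_sum) auto
  then show ?thesis
    using assms by (simp add: nsphere_points_def abs_square_le_1)
qed (use assms in \<open>simp add: nsphere_points_def\<close>)

lemma nsphere_points_nonempty: "nsphere_points n \<noteq> {}"
  using in_topspace_nsphere[of n] by (auto simp: nsphere_eq)

lemma profile_circle: "profile (\<lambda>s. sqrt (1 - s\<^sup>2))"
  by (auto simp: profile_def intro!: continuous_intros) (simp add: abs_square_less_1 abs_less_iff)

lemma profile_diamond: "profile (\<lambda>s. 1 - \<bar>s\<bar>)"
  by (auto simp: profile_def intro!: continuous_intros)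

text \<open>
  The last coordinate is the height; the slice at height \<open>s\<close> is a sphere of radius \<open>sqrt (1 - s\<^sup>2)\<close>.
\<close>

lemma nsphere_points_Suc_homeomorphic:
  "nsphere_points (Suc n) homeomorphic suspension_points (\<lambda>s. sqrt (1 - s\<^sup>2)) (nsphere_points n)"
    (is "?S homeomorphic ?T")
proof -
  define F :: "(nat \<Rightarrow> real) \<Rightarrow> (nat \<Rightarrow> real) \<times> real" where "F = (\<lambda>x. (x(Suc n := 0), x (Suc n)))"
  define G :: "(nat \<Rightarrow> real) \<times> real \<Rightarrow> (nat \<Rightarrow> real)" where "G = (\<lambda>(y, s). y(Suc n := s))"
  have sum_upd: "(\<Sum>i\<le>n. ((x(Suc n := c)) i)\<^sup>2) = (\<Sum>i\<le>n. (x i)\<^sup>2)" for x and c :: real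
    by (intro sum.cong) auto
  have "homeomorphism ?S ?T F G"
  proof
    show "continuous_on ?S F"
      unfolding F_def
      by (intro continuous_intros continuous_on_coordinate)
    have "continuous_on ?T (\<lambda>p. (fst p)(Suc n := snd p))"
      by (intro continuous_intros)
    then show "continuous_on ?T G"
      by (simp add: G_def case_prod_unfold)
    show "F ` ?S \<subseteq> ?T"
    proof (rule image_subsetI)
      fix x assume x: "x \<in> ?S"
      define s where "s = x (Suc n)"
      have s: "s \<in> {-1..1}"
        using nsphere_points_bounded[OF x, of "Suc n"] by (auto simp: s_def)
      have sq: "(\<Sum>i\<le>n. (x i)\<^sup>2) = 1 - s\<^sup>2"
        using x by (simp add: nsphere_points_def s_def)
      show "F x \<in> ?T"
      proof (cases "s\<^sup>2 = 1")
        case True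
        then have "\<forall>i\<le>n. x i = 0"
          using sq by (simp add: sum_nonneg_eq_0_iff)
        then have zero: "x v = 0" if "v \<noteq> Suc n" for v
          using x that by (cases "v \<le> n") (auto simp: nsphere_points_def)
        have "F x = ((\<lambda>v. sqrt (1 - s\<^sup>2) * y v), s)" for y
          using x True zero by (auto simp: F_def s_def fun_eq_iff)
        then show ?thesis
          using nsphere_points_nonempty[of n] s by (auto simp: suspension_points_def)
      next
        case False
        then have pos: "0 < 1 - s\<^sup>2"
          using s by (auto simp: abs_square_le_1 abs_le_iff less_le)
        let ?y = "\<lambda>v. (x(Suc n := 0)) v / sqrt (1 - s\<^sup>2)"
        have "(\<Sum>i\<le>n. (?y i)\<^sup>2) = (\<Sum>i\<le>n. (x i)\<^sup>2) / (1 - s\<^sup>2)"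
          unfolding sum_divide_distrib using pos by (intro sum.cong) (auto simp: power_divide)
        then have "?y \<in> nsphere_points n"
          using pos sq x by (auto simp: nsphere_points_def)
        moreover have "F x = (\<lambda>v. sqrt (1 - s\<^sup>2) * ?y v, s)"
          using pos by (auto simp: F_def s_def fun_eq_iff)
        ultimately show ?thesis
          using s by (intro suspension_pointsI)
      qed
    qed
    show "G ` ?T \<subseteq> ?S"
    proof (rule image_subsetI)
      fix p assume "p \<in> ?T"
      then obtain y s where y: "y \<in> nsphere_points n" and s: "s \<in> {-1..1}"
        and p: "p = (\<lambda>v. sqrt (1 - s\<^sup>2) * y v, s)"
        by (auto simp: suspension_points_def)
      have "(\<Sum>i\<le>n. (sqrt (1 - s\<^sup>2) * y i)\<^sup>2) = (1 - s\<^sup>2) * (\<Sum>i\<le>n. (y i)\<^sup>2)"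
        unfolding sum_distrib_left using s
        by (intro sum.cong) (auto simp: power_mult_distrib abs_square_le_1 abs_le_iff)
      then show "G p \<in> ?S"
        using y by (auto simp: G_def p nsphere_points_def sum_upd)
    qed
    show "G (F x) = x" for x
      by (simp add: F_def G_def)
    show "F (G p) = p" if "p \<in> ?T" for p
      using that by (auto simp: F_def G_def suspension_points_def nsphere_points_def)
  qed
  then show ?thesis by (auto simp: homeomorphic_def)
qed

section \<open>Suspensions of simplicial spheres\<close>

definition suspension :: "'a \<Rightarrow> 'a \<Rightarrow> 'a set set \<Rightarrow> 'a set set" where
  "suspension a b L = L \<union> {{a}, {b}} \<union> insert a ` L \<union> insert b ` L"

text \<open>
  Treating the empty set as a face of \<open>L\<close> makes the two apexes cones over faces like the other new faces.
\<close>

lemma mem_suspension_iff: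
  "\<sigma> \<in> suspension a b L \<longleftrightarrow> \<sigma> \<in> L \<or> (\<exists>c\<in>{a, b}. \<exists>\<tau>\<in>insert {} L. \<sigma> = insert c \<tau>)"
  by (auto simp: suspension_def)

lemma abstract_simplicial_complex_suspension:
  assumes "abstract_simplicial_complex L"
  shows "abstract_simplicial_complex (suspension a b L)"
  unfolding abstract_simplicial_complex_def
proof (intro conjI ballI allI impI)
  have L: "finite L" "\<And>\<sigma>. \<sigma> \<in> L \<Longrightarrow> finite \<sigma> \<and> \<sigma> \<noteq> {}"
    and down: "\<And>\<sigma> \<tau>. \<sigma> \<in> insert {} L \<Longrightarrow> \<tau> \<subseteq> \<sigma> \<Longrightarrow> \<tau> \<in> insert {} L"
    using assms unfolding abstract_simplicial_complex_def by blast+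
  show "finite (suspension a b L)"
    using L by (simp add: suspension_def)
  fix \<sigma> assume \<sigma>: "\<sigma> \<in> suspension a b L"
  then show "finite \<sigma>" "\<sigma> \<noteq> {}"
    using L(2) by (auto simp: suspension_def)
  fix \<tau> assume \<tau>: "\<tau> \<subseteq> \<sigma> \<and> \<tau> \<noteq> {}"
  from \<sigma> consider "\<sigma> \<in> L" | c \<rho> where "c \<in> {a, b}" "\<rho> \<in> insert {} L" "\<sigma> = insert c \<rho>"
    by (auto simp: mem_suspension_iff)
  then show "\<tau> \<in> suspension a b L"
  proof cases
    case 1
    then show ?thesis
      using down[of \<sigma> \<tau>] \<tau> by (auto simp: suspension_def)
  next
    case 2
    then have "\<tau> - {c} \<in> insert {} L"
      using down[of \<rho> "\<tau> - {c}"] \<tau> by blast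
    moreover have "\<tau> = \<tau> - {c} \<or> \<tau> = insert c (\<tau> - {c})"
      by blast
    ultimately show ?thesis
      using 2(1) \<tau> unfolding mem_suspension_iff by (metis insertE)
  qed
qed

lemma realized_points_bounded:
  assumes "abstract_simplicial_complex K" "x \<in> realized_points K"
  shows "\<bar>x v\<bar> \<le> 1"
proof (cases "x v = 0")
  case False
  have "finite {v. x v \<noteq> 0}"
    using assms by (auto simp: realized_points_def abstract_simplicial_complex_def)
  then have "x v \<le> (\<Sum>v | x v \<noteq> 0. x v)"
    using assms False by (intro member_le_sum) (auto simp: realized_points_def)
  then show ?thesis
    using assms by (auto simp: realized_points_def)
qed simp

text \<open>
  No face contains both apexes, so the barycentric coordinates at \<open>a\<close> and \<open>b\<close> are the positive and the negative
  part of one height \<open>s = x a - x b\<close>. The other coordinates have sum \<open>1 - |s|\<close> and, divided by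
  this sum, are a point of the realization of \<open>L\<close>. Nonemptiness of that realization matters: the rescaled
  suspension of the empty set has no poles.
\<close>

lemma realized_points_suspension_homeomorphic:
  fixes L :: "'a set set"
  assumes L: "abstract_simplicial_complex L" and ne: "realized_points L \<noteq> {}"
    and ab: "a \<noteq> b" "a \<notin> \<Union>L" "b \<notin> \<Union>L"
  shows "realized_points (suspension a b L) homeomorphic
           suspension_points (\<lambda>s. 1 - \<bar>s\<bar>) (realized_points L)" (is "?S homeomorphic ?T")
proof -
  define F :: "('a \<Rightarrow> real) \<Rightarrow> ('a \<Rightarrow> real) \<times> real" where
    "F = (\<lambda>x. (x(a := 0, b := 0), x a - x b))"
  define G :: "('a \<Rightarrow> real) \<times> real \<Rightarrow> ('a \<Rightarrow> real)" where
    "G = (\<lambda>(y, s). y(a := max s 0, b := max (- s) 0))"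
  have fin: "finite {v. x v \<noteq> 0}" if "x \<in> realized_points L" for x
    using that L by (auto simp: realized_points_def abstract_simplicial_complex_def)
  have avoid: "x a = 0" "x b = 0" if "x \<in> realized_points L" for x
    using that ab by (auto simp: realized_points_def)
  have apex: "x a * x b = 0" and split:
      "x a + x b + (\<Sum>v \<in> {v. x v \<noteq> 0} - {a, b}. x v) = 1" and finS: "finite {v. x v \<noteq> 0}"
      and rest: "{v. x v \<noteq> 0} - {a, b} \<in> insert {} L" and nn: "\<And>v. 0 \<le> x v"
    if x: "x \<in> ?S" for x
  proof -
    have supp: "{v. x v \<noteq> 0} \<in> suspension a b L"
      using x by (simp add: realized_points_def)
    show fin: "finite {v. x v \<noteq> 0}"
      using supp abstract_simplicial_complex_suspension[OF L, of a b]
      by (auto simp: abstract_simplicial_complex_def)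
    show "x a * x b = 0"
    proof (rule ccontr)
      assume "x a * x b \<noteq> 0"
      then have "a \<in> {v. x v \<noteq> 0}" "b \<in> {v. x v \<noteq> 0}"
        by auto
      moreover have "\<not> (a \<in> \<sigma> \<and> b \<in> \<sigma>)" if "\<sigma> \<in> suspension a b L" for \<sigma>
        using that ab by (auto simp: suspension_def)
      ultimately show False
        using supp by blast
    qed
    have "1 = (\<Sum>v | x v \<noteq> 0. x v)"
      using x by (simp add: realized_points_def)
    also have "\<dots> = (\<Sum>v \<in> insert a (insert b ({v. x v \<noteq> 0} - {a, b})). x v)"
      using fin by (intro sum.mono_neutral_left) auto
    also have "\<dots> = x a + x b + (\<Sum>v \<in> {v. x v \<noteq> 0} - {a, b}. x v)"
      using fin ab by simp
    finally show "x a + x b + (\<Sum>v \<in> {v. x v \<noteq> 0} - {a, b}. x v) = 1" by simp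
    have *: "\<And>\<tau>. \<tau> \<in> L \<Longrightarrow> \<tau> - {a, b} = \<tau>" "\<And>c \<tau>. \<tau> \<in> L \<Longrightarrow> c \<in> {a, b} \<Longrightarrow> insert c \<tau> - {a, b} = \<tau>"
      using ab by blast+
    show "{v. x v \<noteq> 0} - {a, b} \<in> insert {} L"
      using supp unfolding mem_suspension_iff
      by (elim disjE bexE) (auto simp: *)
    show "0 \<le> x v" for v
      using x by (simp add: realized_points_def)
  qed
  have "homeomorphism ?S ?T F G"
  proof
    show "continuous_on ?S F"
      unfolding F_def
      by (intro continuous_intros continuous_on_coordinate)
    have "continuous_on ?T (\<lambda>p. (fst p)(a := max (snd p) 0, b := max (- snd p) 0))"
      by (intro continuous_intros)
    then show "continuous_on ?T G"
      by (simp add: G_def case_prod_unfold)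
    show GF: "G (F x) = x" if "x \<in> ?S" for x
    proof -
      have "x a = max (x a - x b) 0" "x b = max (x b - x a) 0"
        using apex[OF that] nn[OF that, of a] nn[OF that, of b] by auto
      then show ?thesis
        by (simp add: F_def G_def fun_eq_iff)
    qed
    show FG: "F (G p) = p" if "p \<in> ?T" for p
      using that ab(1) avoid
      by (auto simp: F_def G_def suspension_points_def fun_eq_iff)
    show "F ` ?S \<subseteq> ?T"
    proof (rule image_subsetI)
      fix x assume x: "x \<in> ?S"
      define s where "s = x a - x b"
      define \<tau> where "\<tau> = {v. x v \<noteq> 0} - {a, b}"
      have abs_s: "\<bar>s\<bar> = x a + x b"
        using apex[OF x] nn[OF x, of a] nn[OF x, of b] by (auto simp: s_def)
      have sum: "(\<Sum>v\<in>\<tau>. x v) = 1 - \<bar>s\<bar>"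
        using split[OF x] abs_s by (simp add: \<tau>_def)
      have s: "s \<in> {-1..1}"
        using sum sum_nonneg[of \<tau> x] nn[OF x] by (auto simp: abs_le_iff)
      show "F x \<in> ?T"
      proof (cases "\<bar>s\<bar> = 1")
        case True
        then have "(\<Sum>v\<in>\<tau>. x v) = 0" "finite \<tau>"
          using sum finS[OF x] by (auto simp: \<tau>_def)
        then have "\<forall>v\<in>\<tau>. x v = 0"
          using nn[OF x] by (simp add: sum_nonneg_eq_0_iff)
        \<comment> \<open>At a pole every point of the base represents the same point.\<close>
        then have "F x = ((\<lambda>v. (1 - \<bar>s\<bar>) * y v), s)" for y
          using True by (auto simp: F_def s_def \<tau>_def fun_eq_iff)
        then show ?thesis
          using ne s by (auto simp: suspension_points_def)
      next
        case False
        then have pos: "0 < 1 - \<bar>s\<bar>"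
          using s by (auto simp: abs_if split: if_splits)
        let ?y = "\<lambda>v. (x(a := 0, b := 0)) v / (1 - \<bar>s\<bar>)"
        have supp: "{v. ?y v \<noteq> 0} = \<tau>"
          using pos by (auto simp: \<tau>_def)
        have "(\<Sum>v\<in>\<tau>. ?y v) = (\<Sum>v\<in>\<tau>. x v) / (1 - \<bar>s\<bar>)"
          unfolding sum_divide_distrib by (intro sum.cong) (auto simp: \<tau>_def)
        also have "\<dots> = 1"
          using sum pos by simp
        finally have one: "(\<Sum>v\<in>\<tau>. ?y v) = 1" .
        then have "\<tau> \<in> L"
          using rest[OF x] by (auto simp: \<tau>_def[symmetric])
        then have "?y \<in> realized_points L"
          unfolding realized_points_def mem_Collect_eq supp using one pos nn[OF x] by auto
        moreover have "F x = (\<lambda>v. (1 - \<bar>s\<bar>) * ?y v, s)"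
          using pos by (auto simp: F_def s_def fun_eq_iff)
        ultimately show ?thesis
          using s by (intro suspension_pointsI)
      qed
    qed
    show "G ` ?T \<subseteq> ?S"
    proof (rule image_subsetI)
      fix p assume "p \<in> ?T"
      then obtain y s where y: "y \<in> realized_points L" and s: "s \<in> {-1..1}"
        and p: "p = (\<lambda>v. (1 - \<bar>s\<bar>) * y v, s)"
        by (auto simp: suspension_points_def)
      define x where "x = G p"
      define \<tau> where "\<tau> = {v. y v \<noteq> 0}"
      have \<tau>: "\<tau> \<in> L" "finite \<tau>" "a \<notin> \<tau>" "b \<notin> \<tau>" "(\<Sum>v\<in>\<tau>. y v) = 1"
        using y fin[OF y] ab by (auto simp: \<tau>_def realized_points_def)
      have x: "x = (\<lambda>v. (1 - \<bar>s\<bar>) * y v)(a := max s 0, b := max (- s) 0)"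
        by (simp add: x_def G_def p)
      have supp: "{v. x v \<noteq> 0} = (if \<bar>s\<bar> = 1 then {} else \<tau>) \<union>
          (if s > 0 then {a} else if s < 0 then {b} else {})"
        using ab(1) \<tau> avoid[OF y] by (auto simp: x \<tau>_def max_def)
      have "(\<Sum>v | x v \<noteq> 0. x v) = (\<Sum>v\<in>insert a (insert b \<tau>). x v)"
      proof (rule sum.mono_neutral_left)
        show "{v. x v \<noteq> 0} \<subseteq> insert a (insert b \<tau>)"
          unfolding supp by auto
      qed (use \<tau> in auto)
      also have "\<dots> = x a + x b + (\<Sum>v\<in>\<tau>. x v)"
        using \<tau> ab(1) by simp
      also have "(\<Sum>v\<in>\<tau>. x v) = (1 - \<bar>s\<bar>) * (\<Sum>v\<in>\<tau>. y v)"
        unfolding sum_distrib_left using \<tau> by (intro sum.cong) (auto simp: x)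
      also have "x a + x b + \<dots> = 1"
        using ab(1) \<tau> by (auto simp: x max_def)
      finally have sum: "(\<Sum>v | x v \<noteq> 0. x v) = 1" .
      have "{v. x v \<noteq> 0} \<in> suspension a b L"
        unfolding supp using \<tau>(1) s by (auto simp: suspension_def)
      moreover have "0 \<le> x v" for v
        using y s by (auto simp: x realized_points_def)
      ultimately show "G p \<in> ?S"
        using sum unfolding x_def[symmetric] realized_points_def by blast
    qed
  qed
  then show ?thesis by (auto simp: homeomorphic_def)
qed

lemma simplicial_sphere_suspension:
  assumes L: "simplicial_sphere d L" and ab: "a \<noteq> b" "a \<notin> \<Union>L" "b \<notin> \<Union>L"
  shows "simplicial_sphere (Suc d) (suspension a b L)"
proof -
  have cx: "abstract_simplicial_complex L" and hom: "realized_points L homeomorphic nsphere_points d"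
    using L by (auto simp: simplicial_sphere_iff)
  have "realized_points L \<noteq> {}"
    using hom nsphere_points_nonempty[of d] homeomorphic_empty(2) homeomorphic_sym by metis
  then have "realized_points (suspension a b L) homeomorphic
      suspension_points (\<lambda>s. 1 - \<bar>s\<bar>) (realized_points L)"
    by (rule realized_points_suspension_homeomorphic[OF cx _ ab])
  also have "\<dots> homeomorphic suspension_points (\<lambda>s. sqrt (1 - s\<^sup>2)) (nsphere_points d)"
    using hom profile_diamond profile_circle realized_points_bounded[OF cx] nsphere_points_bounded
    by (intro suspension_points_homeomorphic) auto
  also have "\<dots> homeomorphic nsphere_points (Suc d)"
    using nsphere_points_Suc_homeomorphic homeomorphic_sym by blast
  finally show ?thesis
    using abstract_simplicial_complex_suspension[OF cx] by (simp add: simplicial_sphere_iff)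
qed

section \<open>Cycles are triangulated circles\<close>

definition generated_complex :: "'a set set \<Rightarrow> 'a set set" where
  "generated_complex H = {\<sigma>. \<sigma> \<noteq> {} \<and> (\<exists>e\<in>H. \<sigma> \<subseteq> e)}"

lemma abstract_simplicial_complex_generated:
  assumes "finite H" "\<And>e. e \<in> H \<Longrightarrow> finite e"
  shows "abstract_simplicial_complex (generated_complex H)"
proof -
  have "generated_complex H \<subseteq> Pow (\<Union>H)"
    by (auto simp: generated_complex_def)
  then have "finite (generated_complex H)"
    using assms by (meson finite_Pow_iff finite_Union finite_subset)
  then show ?thesis
    using assms finite_subset unfolding abstract_simplicial_complex_def generated_complex_def
    by (intro conjI) (assumption, blast, blast)
qed

definition closed_cell :: "'a set \<Rightarrow> ('a \<Rightarrow> real) set" where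
  "closed_cell \<sigma> = {x. (\<forall>v. 0 \<le> x v) \<and> {v. x v \<noteq> 0} \<subseteq> \<sigma> \<and> (\<Sum>v | x v \<noteq> 0. x v) = 1}"

text \<open>
  Simplices spanned by vertex sets meet exactly in the simplex on the common vertices. This turns the
  separation conditions for joining arcs into statements about vertex sets.
\<close>

lemma closed_cell_Int: "closed_cell \<sigma> \<inter> closed_cell \<tau> = closed_cell (\<sigma> \<inter> \<tau>)"
  by (auto simp: closed_cell_def)

lemma closed_cell_mono: "\<sigma> \<subseteq> \<tau> \<Longrightarrow> closed_cell \<sigma> \<subseteq> closed_cell \<tau>"
  by (auto simp: closed_cell_def)

lemma realized_points_generated: "realized_points (generated_complex H) = (\<Union>e\<in>H. closed_cell e)"
proof -
  have supp_ne: "(\<Sum>v | x v \<noteq> 0. x v) = 1 \<longrightarrow> {v. x v \<noteq> 0} \<noteq> {}" for x :: "'a \<Rightarrow> real"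
    by (metis sum.empty zero_neq_one)
  have "x \<in> realized_points (generated_complex H) \<longleftrightarrow> x \<in> (\<Union>e\<in>H. closed_cell e)" for x
    using supp_ne[of x] unfolding realized_points_def generated_complex_def closed_cell_def UN_iff mem_Collect_eq
    by blast
  then show ?thesis by blast
qed

definition vertex_point :: "'a \<Rightarrow> 'a \<Rightarrow> real" where
  "vertex_point a = (\<lambda>_. 0)(a := 1)"

text \<open>
  The function space carries no norm, so the segment between two vertices is written in coordinates.
\<close>

definition edge_path :: "'a \<Rightarrow> 'a \<Rightarrow> real \<Rightarrow> 'a \<Rightarrow> real" where
  "edge_path a b t = (\<lambda>_. 0)(a := 1 - t, b := t)"

lemma closed_cell_edge:
  assumes "a \<noteq> b"
  shows "closed_cell {a, b} = edge_path a b ` {0..1}"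
proof (intro equalityI subsetI)
  fix x assume x: "x \<in> closed_cell {a, b}"
  then have supp: "{v. x v \<noteq> 0} \<subseteq> {a, b}" and nn: "\<And>v. 0 \<le> x v"
    by (auto simp: closed_cell_def)
  have "1 = (\<Sum>v | x v \<noteq> 0. x v)"
    using x by (simp add: closed_cell_def)
  also have "\<dots> = (\<Sum>v\<in>{a, b}. x v)"
    using supp by (intro sum.mono_neutral_left) auto
  also have "\<dots> = x a + x b"
    using assms by simp
  finally have "x a = 1 - x b" by simp
  moreover have "x v = 0" if "v \<noteq> a" "v \<noteq> b" for v
    using supp that by blast
  ultimately have "x = edge_path a b (x b)" "x b \<in> {0..1}"
    using nn[of a] nn[of b] by (auto simp: edge_path_def fun_eq_iff)
  then show "x \<in> edge_path a b ` {0..1}" by blast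
next
  fix x assume "x \<in> edge_path a b ` {0..1}"
  then obtain t where t: "t \<in> {0..1}" and x: "x = edge_path a b t" by blast
  have supp: "{v. x v \<noteq> 0} \<subseteq> {a, b}"
    by (auto simp: x edge_path_def split: if_splits)
  then have "(\<Sum>v | x v \<noteq> 0. x v) = (\<Sum>v\<in>{a, b}. x v)"
    by (intro sum.mono_neutral_left) auto
  also have "\<dots> = 1"
    using assms by (simp add: x edge_path_def)
  finally show "x \<in> closed_cell {a, b}"
    using supp t by (auto simp: closed_cell_def) (auto simp: x edge_path_def)
qed

lemma closed_cell_vertex: "closed_cell {a} = {vertex_point a}"
proof (intro equalityI subsetI)
  fix x assume x: "x \<in> closed_cell {a}"
  then have supp: "{v. x v \<noteq> 0} \<subseteq> {a}"
    by (auto simp: closed_cell_def)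
  have "1 = (\<Sum>v | x v \<noteq> 0. x v)"
    using x by (simp add: closed_cell_def)
  also have "\<dots> = (\<Sum>v\<in>{a}. x v)"
    using supp by (intro sum.mono_neutral_left) auto
  finally show "x \<in> {vertex_point a}"
    using supp by (auto simp: vertex_point_def fun_eq_iff)
next
  fix x assume "x \<in> {vertex_point a}"
  moreover have "{v. vertex_point a v \<noteq> 0} = {a}"
    by (auto simp: vertex_point_def)
  ultimately show "x \<in> closed_cell {a}"
    by (auto simp: closed_cell_def vertex_point_def)
qed

lemma arc_edge_path:
  assumes "a \<noteq> b"
  shows "arc (edge_path a b)"
  unfolding arc_def
proof
  show "path (edge_path a b)"
    unfolding path_def edge_path_def by (intro continuous_intros)
  show "inj_on (edge_path a b) {0..1}"
    by (rule inj_onI) (metis edge_path_def fun_upd_same)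
qed

lemma edge_path_ends:
  assumes "a \<noteq> b"
  shows "pathstart (edge_path a b) = vertex_point a" "pathfinish (edge_path a b) = vertex_point b"
  using assms by (auto simp: pathstart_def pathfinish_def edge_path_def vertex_point_def fun_eq_iff)

fun walk_edges :: "'a list \<Rightarrow> 'a set set" where
  "walk_edges (a # b # xs) = insert {a, b} (walk_edges (b # xs))"
| "walk_edges _ = {}"

lemma walk_edges_subset: "e \<in> walk_edges xs \<Longrightarrow> e \<subseteq> set xs"
  by (induction xs rule: walk_edges.induct) auto

lemma finite_walk_edges: "finite (walk_edges xs)"
  by (induction xs rule: walk_edges.induct) auto

text \<open>
  The first edge meets the rest of the walk only in its second vertex because the vertices are distinct, so the
  edges can be joined to an arc one by one.
\<close>

lemma ex_arc_along_walk:
  assumes "distinct xs" "length xs \<ge> 2"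
  shows "\<exists>g. arc g \<and> pathstart g = vertex_point (hd xs) \<and> pathfinish g = vertex_point (last xs) \<and>
           path_image g = (\<Union>e\<in>walk_edges xs. closed_cell e)"
  using assms
proof (induction xs rule: walk_edges.induct)
  case (1 a b xs)
  then have ab: "a \<noteq> b" by auto
  have img: "path_image (edge_path a b) = closed_cell {a, b}"
    by (simp add: path_image_def closed_cell_edge[OF ab])
  show ?case
  proof (cases xs)
    case Nil
    then show ?thesis
      using arc_edge_path[OF ab] edge_path_ends[OF ab] img by (intro exI[of _ "edge_path a b"]) auto
  next
    case (Cons c ys)
    then obtain g where g: "arc g" "pathstart g = vertex_point b" "pathfinish g = vertex_point (last (b # xs))"
        "path_image g = (\<Union>e\<in>walk_edges (b # xs). closed_cell e)"
      using 1 by auto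
    have "closed_cell {a, b} \<inter> closed_cell e \<subseteq> {vertex_point b}" if "e \<in> walk_edges (b # xs)" for e
    proof -
      have "{a, b} \<inter> e \<subseteq> {b}"
        using walk_edges_subset[OF that] "1.prems"(1) by auto
      then show ?thesis
        using closed_cell_mono unfolding closed_cell_Int closed_cell_vertex[symmetric] by blast
    qed
    then have "path_image (edge_path a b) \<inter> path_image g \<subseteq> {pathstart g}"
      unfolding img g by blast
    then have "arc (edge_path a b +++ g)"
      using g edge_path_ends[OF ab] by (intro arc_join arc_edge_path ab) auto
    then show ?thesis
      using g edge_path_ends[OF ab] img Cons
      by (intro exI[of _ "edge_path a b +++ g"]) (auto simp: path_image_join)
  qed
qed auto

text \<open>
  The edge that closes the cycle is new; for two vertices it would coincide with the only edge of the walk.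
\<close>

lemma hd_last_not_walk_edge:
  assumes "distinct xs" "length xs \<ge> 3"
  shows "{hd xs, last xs} \<notin> walk_edges xs"
proof
  assume mem: "{hd xs, last xs} \<in> walk_edges xs"
  obtain a b c ys where xs: "xs = a # b # c # ys"
    using assms(2) by (cases xs; cases "tl xs"; cases "tl (tl xs)") auto
  have "{a, last (c # ys)} \<noteq> {a, b}"
    using assms(1) xs last_in_set[of "c # ys"] by (auto simp: doubleton_eq_iff)
  moreover have "{a, last (c # ys)} \<notin> walk_edges (b # c # ys)"
    using walk_edges_subset[of _ "b # c # ys"] assms(1) xs by fastforce
  ultimately show False
    using mem by (simp add: xs)
qed

lemma circle_homeomorphic_nsphere_points: "sphere (0::complex) 1 homeomorphic nsphere_points 1"
proof -
  define f :: "complex \<Rightarrow> nat \<Rightarrow> real" where "f z = (\<lambda>_. 0)(0 := Re z, 1 := Im z)" for z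
  define g :: "(nat \<Rightarrow> real) \<Rightarrow> complex" where "g x = of_real (x 0) + \<i> * of_real (x 1)" for x
  have "homeomorphism (sphere 0 1) (nsphere_points 1) f g"
  proof
    show "continuous_on (sphere 0 1) f"
      unfolding f_def by (intro continuous_intros)
    show "continuous_on (nsphere_points 1) g"
      unfolding g_def by (intro continuous_intros continuous_on_coordinate)
    show "f ` sphere 0 1 \<subseteq> nsphere_points 1"
      by (auto simp: f_def nsphere_points_def cmod_def)
    show "g ` nsphere_points 1 \<subseteq> sphere 0 1"
      by (auto simp: g_def nsphere_points_def cmod_def)
    show "g (f z) = z" for z
      by (simp add: f_def g_def complex_eq_iff)
    show "f (g x) = x" if x: "x \<in> nsphere_points 1" for x
    proof
      fix i show "f (g x) i = x i"
        using x by (cases "i \<le> 1") (auto simp: f_def g_def nsphere_points_def le_Suc_eq)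
    qed
  qed
  then show ?thesis by (auto simp: homeomorphic_def)
qed

text \<open>
  The arc along the walk and the closing edge have only their endpoints in common, so together they form a simple
  closed path, and in a Hausdorff space the image of such a path is homeomorphic to a circle. Countability of the vertex
  type makes the function space metric, hence Hausdorff.
\<close>

lemma simplicial_sphere_cycle:
  fixes xs :: "'a::countable list"
  assumes xs: "distinct xs" "length xs \<ge> 3"
  shows "simplicial_sphere 1 (generated_complex (insert {hd xs, last xs} (walk_edges xs)))"
proof -
  obtain g where g: "arc g" "pathstart g = vertex_point (hd xs)" "pathfinish g = vertex_point (last xs)"
      "path_image g = (\<Union>e\<in>walk_edges xs. closed_cell e)"
    using ex_arc_along_walk[of xs] xs by auto
  let ?E = "insert {hd xs, last xs} (walk_edges xs)"
  let ?h = "edge_path (last xs) (hd xs)"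
  obtain a b ys where ab_ys: "xs = a # b # ys"
    using xs(2) by (cases xs; cases "tl xs") auto
  then have ne: "last xs \<noteq> hd xs"
    using xs(1) last_in_set[of "b # ys"] by auto
  have img: "path_image ?h = closed_cell {hd xs, last xs}"
    unfolding path_image_def closed_cell_edge[OF ne, symmetric] by (simp add: insert_commute)
  have "closed_cell e \<inter> closed_cell {hd xs, last xs} \<subseteq> {vertex_point (hd xs), vertex_point (last xs)}"
    if e: "e \<in> walk_edges xs" for e
  proof -
    have "card e \<le> 2"
      using e by (induction xs rule: walk_edges.induct) (auto simp: card_insert_if)
    then have "e \<inter> {hd xs, last xs} \<noteq> {hd xs, last xs}"
      using hd_last_not_walk_edge[OF xs] e ne
        card_seteq[of e "{hd xs, last xs}"] walk_edges_subset[OF e] finite_subset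
      by (metis List.finite_set card_2_iff inf_le1)
    then have "e \<inter> {hd xs, last xs} \<subseteq> {hd xs} \<or> e \<inter> {hd xs, last xs} \<subseteq> {last xs}"
      by blast
    then have "closed_cell (e \<inter> {hd xs, last xs}) \<subseteq> closed_cell {hd xs} \<or>
        closed_cell (e \<inter> {hd xs, last xs}) \<subseteq> closed_cell {last xs}"
      by (elim disjE) (simp_all only: closed_cell_mono simp_thms)
    then show ?thesis
      unfolding closed_cell_Int closed_cell_vertex by blast
  qed
  then have "path_image g \<inter> path_image ?h \<subseteq> {pathstart g, pathstart ?h}"
    unfolding img g edge_path_ends[OF ne] by blast
  then have "simple_path (g +++ ?h)"
    using g edge_path_ends[OF ne] by (intro simple_path_join_loop arc_edge_path ne) auto
  moreover have "path_image (g +++ ?h) = realized_points (generated_complex ?E)"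
    using g img edge_path_ends[OF ne]
    by (simp add: path_image_join realized_points_generated Un_commute)
  ultimately have "realized_points (generated_complex ?E) homeomorphic sphere (0::complex) 1"
    using homeomorphic_simple_path_image_circle[of "g +++ ?h" 1 0] g edge_path_ends[OF ne] by simp
  also have "\<dots> homeomorphic nsphere_points 1"
    by (rule circle_homeomorphic_nsphere_points)
  finally have "realized_points (generated_complex ?E) homeomorphic nsphere_points 1" .
  moreover have "finite e" if "e \<in> ?E" for e
    using that finite_subset[OF walk_edges_subset[of e xs]] by auto
  ultimately show ?thesis
    unfolding simplicial_sphere_iff
    using abstract_simplicial_complex_generated[of ?E] finite_walk_edges by blast
qed

section \<open>Cycles in graphs with many edges\<close>

text \<open>
  In a longest path all neighbours of the first vertex lie on the path. It has a neighbour other than its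
  successor, and the edge to that neighbour closes an initial segment of the path to a cycle.
\<close>

lemma ex_cycle_if_min_degree_2:
  assumes fin: "finite E" and E: "\<And>e. e \<in> E \<Longrightarrow> card e = 2" and ne: "E \<noteq> {}"
    and deg: "\<And>v e. e \<in> E \<Longrightarrow> v \<in> e \<Longrightarrow> \<exists>e'\<in>E. v \<in> e' \<and> e' \<noteq> e"
  shows "\<exists>xs. distinct xs \<and> length xs \<ge> 3 \<and> insert {hd xs, last xs} (walk_edges xs) \<subseteq> E"
proof -
  let ?P = "\<lambda>xs. distinct xs \<and> length xs \<ge> 2 \<and> walk_edges xs \<subseteq> E"
  have walk_in: "set xs \<subseteq> \<Union>E" if "?P xs" for xs
  proof -
    have "set xs \<subseteq> \<Union>(walk_edges xs)" if "length xs \<ge> 2" for xs :: "'a list"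
      using that
    proof (induction xs rule: walk_edges.induct)
      case (1 a b xs) then show ?case by (cases xs) auto
    qed auto
    then show ?thesis using that by blast
  qed
  have finV: "finite (\<Union>E)"
    using fin E by (metis card.infinite finite_Union zero_neq_numeral)
  have bound: "length xs \<le> card (\<Union>E)" if "?P xs" for xs
    using walk_in[OF that] that finV by (metis card_mono distinct_card)
  obtain a b where "{a, b} \<in> E" "a \<noteq> b"
    using ne E by (metis card_2_iff ex_in_conv)
  then have "?P [a, b]" by auto
  then obtain xs where xs: "?P xs" and longest: "\<And>ys. ?P ys \<Longrightarrow> length ys \<le> length xs"
    using ex_has_greatest_nat[of ?P "[a, b]" length "card (\<Union>E) + 1"] bound
    by (metis Suc_eq_plus1 le_imp_less_Suc)
  obtain u v ys where uv: "xs = u # v # ys"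
    using xs by (cases xs; cases "tl xs") auto
  then obtain e where e: "e \<in> E" "u \<in> e" "e \<noteq> {u, v}"
    using deg[of "{u, v}" u] xs by auto
  then obtain w where w: "e = {u, w}" "w \<noteq> u"
    using E[OF e(1)] by (auto simp: card_2_iff)
  have "w \<in> set xs"
  proof (rule ccontr)
    assume "w \<notin> set xs"
    then have "?P (w # xs)"
      using xs e(1) w uv by (auto simp: insert_commute)
    then show False
      using longest by fastforce
  qed
  moreover have "w \<noteq> v"
    using w e(3) by blast
  ultimately have "w \<in> set ys"
    using w uv by simp
  then obtain ps qs where split: "ys = ps @ w # qs"
    by (meson split_list)
  let ?c = "u # v # ps @ [w]"
  have "walk_edges ?c \<subseteq> walk_edges xs"
  proof -
    have "walk_edges (zs @ [w]) \<subseteq> walk_edges (zs @ w # qs)" for zs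
      by (induction zs rule: walk_edges.induct) auto
    from this[of "u # v # ps"] show ?thesis by (simp add: uv split)
  qed
  then have "insert {hd ?c, last ?c} (walk_edges ?c) \<subseteq> E"
    using xs e(1) w by auto
  moreover have "distinct ?c"
    using xs by (auto simp: uv split)
  ultimately show ?thesis
    by (intro exI[of _ ?c]) auto
qed

text \<open>
  Deleting an edge at a vertex of degree one removes at least one vertex together with exactly one edge, so the
  inequality between the two numbers survives until all degrees are at least two.
\<close>

lemma ex_cycle_if_many_edges:
  assumes "finite E" "\<And>e. e \<in> E \<Longrightarrow> card e = 2" "E \<noteq> {}" "card (\<Union>E) \<le> card E"
  shows "\<exists>xs. distinct xs \<and> length xs \<ge> 3 \<and> insert {hd xs, last xs} (walk_edges xs) \<subseteq> E"
  using assms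
proof (induction "card E" arbitrary: E rule: less_induct)
  case less
  show ?case
  proof (cases "\<forall>e\<in>E. \<forall>v\<in>e. \<exists>e'\<in>E. v \<in> e' \<and> e' \<noteq> e")
    case True
    then show ?thesis
      using less.prems by (intro ex_cycle_if_min_degree_2) auto
  next
    case False
    then obtain e v where e: "e \<in> E" "v \<in> e" and leaf: "\<And>e'. e' \<in> E \<Longrightarrow> v \<in> e' \<Longrightarrow> e' = e"
      by blast
    let ?E = "E - {e}"
    have finV: "finite (\<Union>E)"
      using less.prems by (metis card.infinite finite_Union zero_neq_numeral)
    have "\<Union>?E \<subseteq> \<Union>E - {v}"
      using leaf by blast
    then have "card (\<Union>?E) \<le> card (\<Union>E - {v})"
      using finV by (intro card_mono) auto
    also have "\<dots> < card (\<Union>E)"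
      using finV e by (intro card_Diff1_less) auto
    finally have smaller: "card (\<Union>?E) \<le> card ?E"
      using less.prems e by simp
    have "card e \<le> card (\<Union>E)"
      using finV e by (intro card_mono) auto
    then have "2 \<le> card E"
      using less.prems e by fastforce
    then have "card ?E \<noteq> 0"
      using e(1) less.prems(1) by simp
    then have "?E \<noteq> {}"
      by (metis card.empty)
    moreover have "card ?E < card E"
      using e less.prems(1) by (intro psubset_card_mono) auto
    ultimately show ?thesis
      using less.hyps[of ?E] less.prems smaller by blast
  qed
qed

section \<open>Two vertices with a large common link\<close>

text \<open>
  Double counting of the triples \<open>(x, y, e)\<close> with \<open>e \<in> F x \<inter> F y\<close>. Their number is the sum of the squared degrees of
  the elements of \<open>M\<close>, which Cauchy-Schwarz bounds from below; from above, the pairs with \<open>x \<noteq> y\<close>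
  contribute at most \<open>B\<close> each and the diagonal contributes the sum of the cardinalities.
\<close>

lemma sum_card_squared_le:
  fixes F :: "'i \<Rightarrow> 'e set" and B :: real
  assumes fin: "finite V" "finite M" and F: "\<And>x. x \<in> V \<Longrightarrow> F x \<subseteq> M"
    and B: "\<And>x y. x \<in> V \<Longrightarrow> y \<in> V \<Longrightarrow> x \<noteq> y \<Longrightarrow> card (F x \<inter> F y) \<le> B" "0 \<le> B"
  shows "(\<Sum>x\<in>V. real (card (F x)))\<^sup>2 \<le> card M * ((real (card V))\<^sup>2 * B + (\<Sum>x\<in>V. real (card (F x))))"
proof -
  have card_F: "real (card (F x \<inter> A)) = (\<Sum>e\<in>M. of_bool (e \<in> F x \<and> e \<in> A))" if "x \<in> V" for x A
  proof -
    have "{e \<in> M. e \<in> F x \<and> e \<in> A} = F x \<inter> A"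
      using F[OF that] by blast
    then show ?thesis
      using fin(2) by (simp add: sum_of_bool_eq Int_def)
  qed
  define deg where "deg e = (\<Sum>x\<in>V. of_bool (e \<in> F x) :: real)" for e
  have sum_deg: "(\<Sum>x\<in>V. real (card (F x))) = (\<Sum>e\<in>M. deg e)"
    using card_F[of _ UNIV] unfolding deg_def by (subst sum.swap) (simp cong: sum.cong)
  have "(deg e)\<^sup>2 = (\<Sum>x\<in>V. \<Sum>y\<in>V. of_bool (e \<in> F x \<and> e \<in> F y))" for e
    unfolding deg_def power2_eq_square sum_product by (intro sum.cong) auto
  then have "(\<Sum>e\<in>M. (deg e)\<^sup>2) = (\<Sum>e\<in>M. \<Sum>x\<in>V. \<Sum>y\<in>V. of_bool (e \<in> F x \<and> e \<in> F y))"
    by simp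
  also have "\<dots> = (\<Sum>x\<in>V. \<Sum>e\<in>M. \<Sum>y\<in>V. of_bool (e \<in> F x \<and> e \<in> F y))"
    by (rule sum.swap)
  also have "\<dots> = (\<Sum>x\<in>V. \<Sum>y\<in>V. \<Sum>e\<in>M. of_bool (e \<in> F x \<and> e \<in> F y))"
    by (intro sum.cong[OF refl] sum.swap)
  also have "\<dots> = (\<Sum>x\<in>V. \<Sum>y\<in>V. real (card (F x \<inter> F y)))"
    by (intro sum.cong[OF refl]) (simp add: card_F)
  also have "\<dots> \<le> (\<Sum>x\<in>V. \<Sum>y\<in>V. B + (if x = y then real (card (F x)) else 0))"
    using B by (intro sum_mono) auto
  also have "\<dots> = (real (card V))\<^sup>2 * B + (\<Sum>x\<in>V. real (card (F x)))"
    using fin(1) by (simp add: sum.distrib power2_eq_square)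
  finally have "(\<Sum>e\<in>M. (deg e)\<^sup>2) * card M
      \<le> ((real (card V))\<^sup>2 * B + (\<Sum>x\<in>V. real (card (F x)))) * card M"
    by (intro mult_right_mono) auto
  with sum_squared_le_sum_of_squares[of deg M] show ?thesis
    unfolding sum_deg by (simp add: mult.commute)
qed

definition link :: "'a set set \<Rightarrow> 'a \<Rightarrow> 'a set set" where
  "link H x = {e. x \<notin> e \<and> insert x e \<in> H}"

lemma card_le_sum_card_link:
  assumes fin: "finite V" and H: "\<And>e. e \<in> H \<Longrightarrow> e \<subseteq> V \<and> e \<noteq> {}"
  shows "card H \<le> (\<Sum>x\<in>V. card (link H x))"
proof -
  have "link H x \<subseteq> Pow V" for x
    using H by (auto simp: link_def)
  then have finL: "finite (link H x)" for x
    using fin by (meson finite_Pow_iff finite_subset)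
  have "H \<subseteq> (\<lambda>(x, e). insert x e) ` (SIGMA x:V. link H x)"
  proof
    fix e assume e: "e \<in> H"
    then obtain x where x: "x \<in> e" using H by blast
    then have "(x, e - {x}) \<in> (SIGMA x:V. link H x)"
      using H e by (auto simp: link_def insert_absorb)
    then show "e \<in> (\<lambda>(x, e). insert x e) ` (SIGMA x:V. link H x)"
      by (rule rev_image_eqI) (use x in auto)
  qed
  then have "card H \<le> card (SIGMA x:V. link H x)"
    using fin finL by (meson finite_SigmaI surj_card_le)
  then show ?thesis
    using fin finL by (simp add: card_SigmaI)
qed

lemma link_subset:
  assumes "finite V" "H \<subseteq> {e. e \<subseteq> V \<and> card e = Suc m}"
  shows "link H x \<subseteq> {e. e \<subseteq> V \<and> card e = m}"
proof
  fix e assume "e \<in> link H x"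
  then have x: "x \<notin> e" "insert x e \<subseteq> V" "card (insert x e) = Suc m"
    using assms(2) by (auto simp: link_def)
  moreover have "finite e"
    using x(2) assms(1) finite_subset by auto
  ultimately show "e \<in> {e. e \<subseteq> V \<and> card e = m}" by simp
qed

text \<open>
  The exponent of the hypothesis is the one for which the main terms of the double counting balance. The condition
  on \<open>p\<close> keeps the contribution of the diagonal pairs from dominating them.
\<close>

lemma ex_large_common_link:
  fixes V :: "'a set" and p :: real
  assumes fin: "finite V" and H: "H \<subseteq> {e. e \<subseteq> V \<and> card e = Suc m}"
    and p: "real m \<le> p + 2"
    and large: "card H > 2 * real (card V) powr ((p + real m + 2) / 2)"
  shows "\<exists>x\<in>V. \<exists>y\<in>V. x \<noteq> y \<and> card (link H x \<inter> link H y) > 2 * real (card V) powr p"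
proof (rule ccontr)
  assume "\<not> ?thesis"
  then have small: "card (link H x \<inter> link H y) \<le> 2 * real (card V) powr p"
    if "x \<in> V" "y \<in> V" "x \<noteq> y" for x y
    using that by (meson not_less)
  define n where "n = real (card V)"
  define T where "T = (\<Sum>x\<in>V. real (card (link H x)))"
  define M where "M = {e. e \<subseteq> V \<and> card e = m}"
  have H_ne: "H \<noteq> {}"
    using large by (metis card.empty mult_nonneg_nonneg not_less of_nat_0 powr_ge_zero zero_le_numeral)
  then obtain e where "e \<subseteq> V" "card e = Suc m"
    using H by auto
  then have "Suc m \<le> card V"
    using fin card_mono by metis
  then have n1: "1 \<le> n"
    by (simp add: n_def)
  have "\<And>e. e \<in> H \<Longrightarrow> e \<subseteq> V \<and> e \<noteq> {}"
    using H by auto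
  then have "card H \<le> (\<Sum>x\<in>V. card (link H x))"
    by (rule card_le_sum_card_link[OF fin])
  then have "real (card H) \<le> T"
    unfolding T_def of_nat_sum[symmetric] of_nat_le_iff .
  then have T: "T > 2 * n powr ((p + real m + 2) / 2)"
    using large by (simp add: n_def)
  have card_M: "real (card M) \<le> n ^ m"
    using n_subsets[OF fin, of m] binomial_le_pow[of m "card V"] \<open>Suc m \<le> card V\<close>
    by (simp add: M_def n_def flip: of_nat_power)
  have "finite M"
    using fin by (auto simp: M_def)
  then have "T\<^sup>2 \<le> card M * (n\<^sup>2 * (2 * n powr p) + T)"
    unfolding T_def n_def using small link_subset[OF fin H]
    by (intro sum_card_squared_le fin) (auto simp: M_def)
  also have "\<dots> \<le> n ^ m * (n\<^sup>2 * (2 * n powr p) + T)"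
    using card_M n1 by (intro mult_right_mono) (auto simp: T_def intro!: add_nonneg_nonneg sum_nonneg)
  also have "n ^ m * (n\<^sup>2 * (2 * n powr p) + T) = 2 * n powr (p + real m + 2) + n powr m * T"
    using n1 by (simp add: powr_add powr_realpow distrib_left)
  finally have upper: "T\<^sup>2 \<le> 2 * n powr (p + real m + 2) + n powr m * T" .
  have "n powr m \<le> n powr ((p + real m + 2) / 2)"
    using n1 p by (intro powr_mono) auto
  \<comment> \<open>Hence the diagonal term is at most half of the square of T, which leaves the other half for the contradiction.\<close>
  then have half: "n powr m < T / 2"
    using T by simp
  have Tpos: "T > 0"
    using T by (smt (verit) powr_ge_zero)
  have "(2 * n powr ((p + real m + 2) / 2))\<^sup>2 < T\<^sup>2"
    using T by (intro power_strict_mono) auto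
  moreover have "(2 * n powr ((p + real m + 2) / 2))\<^sup>2 = 4 * n powr (p + real m + 2)"
    by (simp add: power_mult_distrib power2_eq_square powr_add[symmetric])
  moreover have "n powr m * T \<le> T / 2 * T"
    using half Tpos by (intro mult_right_mono) auto
  ultimately show False
    using upper by (simp add: power2_eq_square)
qed

section \<open>Many hyperedges force a sphere\<close>

definition sphere_exponent :: "nat \<Rightarrow> real" where
  "sphere_exponent d = real d + 1 - 1 / 2 ^ (d - 1)"

text \<open>
  The induction starts with \<open>d = 1\<close> and not with \<open>d = 0\<close>: two vertices form a 0-sphere, but suspending it would only
  give cycles of length four, for which a linear number of edges does not suffice.
\<close>

lemma ex_simplicial_sphere_if_many_edges:
  fixes V :: "'a::countable set"
  assumes "d \<ge> 1" "finite V" "H \<subseteq> {e. e \<subseteq> V \<and> card e = d + 1}"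
    and "card H > 2 * real (card V) powr sphere_exponent d"
  shows "\<exists>L\<subseteq>generated_complex H. simplicial_sphere d L"
  using assms
proof (induction d arbitrary: H rule: dec_induct)
  case base
  have H: "card e = 2" "e \<subseteq> V" if "e \<in> H" for e
    using base.prems(2) that by auto
  have fin: "finite H"
    using base.prems(1) H by (meson PowI finite_Pow_iff finite_subset subsetI)
  have many: "2 * card V < card H"
    using base.prems(3) by (cases "V = {}") (auto simp: sphere_exponent_def)
  then have "H \<noteq> {}" by auto
  moreover have "card (\<Union>H) \<le> card V"
    using base.prems(1) H by (intro card_mono) auto
  ultimately obtain xs where xs: "distinct xs" "length xs \<ge> 3"
      and sub: "insert {hd xs, last xs} (walk_edges xs) \<subseteq> H"
    using ex_cycle_if_many_edges[of H] fin H many by auto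
  have "generated_complex (insert {hd xs, last xs} (walk_edges xs)) \<subseteq> generated_complex H"
    using sub unfolding generated_complex_def by blast
  then show ?case
    using simplicial_sphere_cycle[OF xs] by blast
next
  case (step d)
  have "1 / 2 ^ (d - 1) \<le> (1::real)"
    by simp
  then have "real (d + 1) \<le> sphere_exponent d + 2"
    unfolding sphere_exponent_def by linarith
  moreover have "(sphere_exponent d + real (d + 1) + 2) / 2 = sphere_exponent (Suc d)"
    using step.hyps(1) by (cases d) (auto simp: sphere_exponent_def field_simps)
  ultimately obtain x y where xy: "x \<in> V" "y \<in> V" "x \<noteq> y"
      and large: "card (link H x \<inter> link H y) > 2 * real (card V) powr sphere_exponent d"
    using ex_large_common_link[of V H "d + 1" "sphere_exponent d"] step.prems by auto
  have "link H x \<inter> link H y \<subseteq> {e. e \<subseteq> V \<and> card e = d + 1}"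
    using link_subset[of V H "d + 1" x] step.prems by auto
  then obtain L where sub: "L \<subseteq> generated_complex (link H x \<inter> link H y)" and L: "simplicial_sphere d L"
    using step.IH[of "link H x \<inter> link H y"] step.prems(1) large by blast
  have face: "\<exists>e. \<sigma> \<subseteq> e \<and> x \<notin> e \<and> y \<notin> e \<and> insert x e \<in> H \<and> insert y e \<in> H" if "\<sigma> \<in> L" for \<sigma>
    using sub that unfolding generated_complex_def link_def by blast
  then have "x \<notin> \<Union>L" "y \<notin> \<Union>L"
    by blast+
  then have "simplicial_sphere (Suc d) (suspension x y L)"
    using simplicial_sphere_suspension[OF L] xy by blast
  moreover have "suspension x y L \<subseteq> generated_complex H"
  proof
    fix \<sigma> assume \<sigma>: "\<sigma> \<in> suspension x y L"
    have "{} \<notin> L"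
      using L by (auto simp: simplicial_sphere_iff abstract_simplicial_complex_def)
    then have ne: "\<sigma> \<noteq> {}"
      using \<sigma> by (auto simp: suspension_def)
    have "link H x \<inter> link H y \<noteq> {}"
    proof
      assume "link H x \<inter> link H y = {}"
      then show False
        using large by (simp add: not_less)
    qed
    then have cone: "\<exists>e. \<tau> \<subseteq> e \<and> insert x e \<in> H \<and> insert y e \<in> H" if "\<tau> \<in> insert {} L" for \<tau>
      using that face[of \<tau>] by (auto simp: link_def)
    from \<sigma> consider "\<sigma> \<in> L" | c \<tau> where "c \<in> {x, y}" "\<tau> \<in> insert {} L" "\<sigma> = insert c \<tau>"
      unfolding mem_suspension_iff by blast
    then have "\<exists>e\<in>H. \<sigma> \<subseteq> e"
    proof cases
      case 1
      then show ?thesis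
        using cone[of \<sigma>] by blast
    next
      case 2
      then obtain e where "\<tau> \<subseteq> e" "insert x e \<in> H" "insert y e \<in> H"
        using cone by blast
      then have "insert c e \<in> H" "\<sigma> \<subseteq> insert c e"
        using 2 by auto
      then show ?thesis by blast
    qed
    then show "\<sigma> \<in> generated_complex H"
      using ne by (simp add: generated_complex_def)
  qed
  ultimately show ?case by blast
qed

theorem proposition3:
  fixes d :: nat
  assumes "d \<ge> 2"
  shows "(\<lambda>n. real (ex_sphere n d)) \<in> O(\<lambda>n. real n powr (real d + 1 - 1 / 2 ^ (d - 1)))"
proof -
  have bound: "real (card (faces_of_dim d K)) \<le> 2 * real n powr sphere_exponent d"
    if K: "K \<in> sphere_free_complexes n d" for K n
  proof (rule ccontr)
    have cx: "abstract_simplicial_complex K" and free: "\<not> (\<exists>L\<subseteq>K. simplicial_sphere d L)"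
      and V: "\<Union>K \<subseteq> {..<n}"
      using K by (auto simp: sphere_free_complexes_def pure_complex_def)
    assume "\<not> ?thesis"
    moreover have "faces_of_dim d K \<subseteq> {e. e \<subseteq> {..<n} \<and> card e = d + 1}"
      using V by (auto simp: faces_of_dim_def)
    ultimately obtain L where "L \<subseteq> generated_complex (faces_of_dim d K)" "simplicial_sphere d L"
      using ex_simplicial_sphere_if_many_edges[of d "{..<n}" "faces_of_dim d K"] assms by auto
    moreover have "generated_complex (faces_of_dim d K) \<subseteq> K"
      using cx unfolding generated_complex_def faces_of_dim_def abstract_simplicial_complex_def by blast
    ultimately show False
      using free by blast
  qed
  have "real (ex_sphere n d) \<le> 2 * real n powr sphere_exponent d" for n
  proof -
    have "ex_sphere n d \<in> (\<lambda>K. card (faces_of_dim d K)) ` sphere_free_complexes n d"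
      unfolding ex_sphere_def
      using finite_sphere_free_complexes[of n d] empty_in_sphere_free_complexes[of n d]
      by (intro Max_in) auto
    then show ?thesis
      using bound by auto
  qed
  then show ?thesis
    unfolding sphere_exponent_def by (intro bigoI[of _ 2] always_eventually allI) simp
qed

end
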